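(* Let $u\in\mathbb{C}$, $u\ne0$, and consider the weight function on the unit circle $$w(\theta)=\tau(u)\,e^{2|u|\sin(\theta+\arg u)},\qquad\theta\in[0,2\pi],$$ where $\tau(u)>0$ is the constant such that $\int_0^{2\pi}w(\theta)\,d\theta=1$. The associated Verblunsky coefficients $\alpha_n$ satisfy $$\overline{iu}\,\alpha_n+iu\,\alpha_{n-2}=\frac{n\,\alpha_{n-1}}{1-|\alpha_{n-1}|^2},\qquad n\ge2.$$
   Context: For a weight function $w$ on $[0,2\pi]$, put $\langle f,g\rangle=\int_0^{2\pi}f(e^{i\theta})\overline{g(e^{i\theta})}\,w(\theta)\,d\theta$. The monic orthogonal polynomials on the unit circle $\Phi_n$ ($n\ge0$) are the monic polynomials of degree $n$ with $\langle\Phi_n,z^k\rangle=0$ for $0\le k\le n-1$. The Verblunsky coefficients are $\alpha_{n-1}=-\overline{\Phi_n(0)}$ for $n\ge0$ (so $\alpha_{-1}=-1$). *)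

theory Defs
  imports "HOL-Complex_Analysis.Complex_Analysis"
    "HOL-Computational_Algebra.Computational_Algebra"
begin

definition circle_inner ::
  "(real \<Rightarrow> real) \<Rightarrow> (complex \<Rightarrow> complex) \<Rightarrow> (complex \<Rightarrow> complex) \<Rightarrow> complex" where
  "circle_inner w f g =
     integral {0..2 * pi} (\<lambda>\<theta>. f (cis \<theta>) * cnj (g (cis \<theta>)) * complex_of_real (w \<theta>))"

definition is_monic_OPUC :: "(real \<Rightarrow> real) \<Rightarrow> nat \<Rightarrow> complex poly \<Rightarrow> bool" where
  "is_monic_OPUC w n P \<longleftrightarrow>
     degree P = n \<and> lead_coeff P = 1 \<and>
     (\<forall>k<n. circle_inner w (poly P) (\<lambda>z. z ^ k) = 0)"

text \<open>The description below denotes a unique polynomial whenever the form induced by the weight is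
  positive definite on polynomials, e.g. for a continuous strictly positive weight.\<close>

definition monic_OPUC :: "(real \<Rightarrow> real) \<Rightarrow> nat \<Rightarrow> complex poly" where
  "monic_OPUC w n = (THE P. is_monic_OPUC w n P)"

text \<open>The index is an integer so that the coefficient at \<open>- 1\<close> is available (it equals \<open>- 1\<close>);
  only indices \<open>\<ge> - 1\<close> are meaningful, as \<open>nat\<close> truncates.\<close>

definition verblunsky :: "(real \<Rightarrow> real) \<Rightarrow> int \<Rightarrow> complex" where
  "verblunsky w k = - cnj (poly (monic_OPUC w (nat (k + 1))) 0)"

end

theory Submission
  imports Defs
begin

text \<open>
  Write \<open>\<langle>P, Q\<rangle>\<close> for the inner product of polynomials on the circle, \<open>\<Phi>\<^sub>n\<close> for the monic
  orthogonal polynomials, \<open>\<Phi>\<^sub>n\<^sup>*(z) = z\<^sup>n cnj (\<Phi>\<^sub>n(1 / cnj z))\<close> for their reversals, and \<open>h\<^sub>n\<close> for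
  \<open>\<langle>\<Phi>\<^sub>n, \<Phi>\<^sub>n\<rangle>\<close>. The logarithmic derivative of the weight is the Laurent polynomial
  \<open>u z + cnj u / z\<close>, so integrating the derivative of \<open>P cnj Q w\<close> over a period yields
  \<open>\<i>\<langle>z P', Q\<rangle> - \<i>\<langle>P, z Q'\<rangle> + u\<langle>z P, Q\<rangle> + cnj u \<langle>P, z Q\<rangle> = 0\<close>
  (\<open>integration_by_parts\<close>).

  The equation of the theorem is this identity for the pair \<open>P = \<Phi>\<^sub>n\<close>, \<open>Q = \<Phi>\<^sub>n\<^sub>-\<^sub>1\<^sup>*\<close>, conjugated.
  Orthogonality evaluates each of the four terms:
  \<open>\<Phi>\<^sub>n\<close> sees only the coefficient of \<open>z\<^sup>n\<close> in a polynomial of degree at most \<open>n\<close>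
  (\<open>form_OPUC_left\<close>), and \<open>\<Phi>\<^sub>n\<^sup>*\<close> sees only the value of such a polynomial at 0 (\<open>form_dual_left\<close>). With
  \<open>a = \<alpha>\<^sub>n\<^sub>-\<^sub>1\<close> the terms are \<open>\<i> n (cnj a) h\<^sub>n\<^sub>-\<^sub>1\<close>, \<open>0\<close>, \<open>u (cnj \<alpha>\<^sub>n) h\<^sub>n\<close> and
  \<open>- cnj u (cnj \<alpha>\<^sub>n\<^sub>-\<^sub>2) h\<^sub>n\<close>, where the third one uses the Szego recurrence
  \<open>\<Phi>\<^sub>n\<^sub>+\<^sub>1 = z \<Phi>\<^sub>n - (cnj \<alpha>\<^sub>n) \<Phi>\<^sub>n\<^sup>*\<close>. Since \<open>h\<^sub>n = (1 - |a|\<^sup>2) h\<^sub>n\<^sub>-\<^sub>1\<close>, dividing by \<open>h\<^sub>n\<close> gives the claim.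

  The polynomials \<open>\<Phi>\<^sub>n\<close> are given by a definite description; the form is positive
  definite, which gives uniqueness, and the Szego recurrence, read as a definition of
  \<open>\<Phi>\<^sub>n\<^sub>+\<^sub>1\<close>, gives existence.
\<close>

section \<open>Reversed polynomials\<close>

text \<open>The reversal \<open>z\<^sup>n cnj (P (1 / cnj z))\<close> is taken with respect to a prescribed \<open>n\<close> rather than
  the degree of \<open>P\<close>, so that the identity \<open>P\<^sup>* cnj Q = Q\<^sup>* cnj P\<close> on the circle also holds
  for polynomials of different degrees.\<close>

definition dual_poly :: "nat \<Rightarrow> complex poly \<Rightarrow> complex poly" where
  "dual_poly n P = (\<Sum>i\<le>n. monom (cnj (coeff P (n - i))) i)"

lemma coeff_dual_poly:
  "coeff (dual_poly n P) i = (if i \<le> n then cnj (coeff P (n - i)) else 0)"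
  unfolding dual_poly_def by (simp add: coeff_sum_monom)
    (simp add: coeff_sum)

lemma degree_dual_poly: "degree (dual_poly n P) \<le> n"
  by (rule degree_le) (auto simp: coeff_dual_poly)

lemma poly_dual_poly_cis:
  assumes "degree P \<le> n"
  shows "poly (dual_poly n P) (cis t) = cis t ^ n * cnj (poly P (cis t))"
proof -
  have inv: "cis t * cnj (cis t) = 1"
    by (simp add: cis_cnj cis_mult)
  have "poly P (cis t) = (\<Sum>i\<le>n. coeff P i * cis t ^ i)"
    using arg_cong[OF poly_as_sum_of_monoms'[OF assms], of "\<lambda>p. poly p (cis t)"]
    by (simp add: poly_sum poly_monom)
  hence "cis t ^ n * cnj (poly P (cis t)) = (\<Sum>i\<le>n. cnj (coeff P i) * (cis t ^ n * cnj (cis t) ^ i))"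
    by (simp add: sum_distrib_left algebra_simps)
  also have "\<dots> = (\<Sum>i\<le>n. cnj (coeff P i) * cis t ^ (n - i))"
  proof (rule sum.cong[OF refl])
    fix i assume "i \<in> {..n}"
    hence "cis t ^ n = cis t ^ (n - i) * cis t ^ i"
      by (simp flip: power_add)
    hence "cis t ^ n * cnj (cis t) ^ i = cis t ^ (n - i) * (cis t * cnj (cis t)) ^ i"
      by (simp only: power_mult_distrib mult.assoc)
    thus "cnj (coeff P i) * (cis t ^ n * cnj (cis t) ^ i) = cnj (coeff P i) * cis t ^ (n - i)"
      by (simp only: inv power_one mult_1_right)
  qed
  also have "\<dots> = (\<Sum>i\<le>n. cnj (coeff P (n - i)) * cis t ^ i)"
    by (rule sum.reindex_bij_witness[of _ "\<lambda>i. n - i" "\<lambda>i. n - i"]) auto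
  also have "\<dots> = poly (dual_poly n P) (cis t)"
    by (simp add: dual_poly_def poly_sum poly_monom)
  finally show ?thesis by simp
qed

section \<open>Orthogonal polynomials for a continuous positive weight\<close>

locale circle_weight =
  fixes w :: "real \<Rightarrow> real"
  assumes continuous_weight: "continuous_on {0..2 * pi} w"
    and weight_pos: "\<And>t. t \<in> {0..2 * pi} \<Longrightarrow> w t > 0"
begin

definition form :: "complex poly \<Rightarrow> complex poly \<Rightarrow> complex" where
  "form P Q = circle_inner w (poly P) (poly Q)"

lemma continuous_integrand:
  "continuous_on {0..2 * pi}
     (\<lambda>t. poly P (cis t) * cnj (poly Q (cis t)) * complex_of_real (w t))"
  by (intro continuous_intros continuous_weight)

lemma integrand_integrable:
  "(\<lambda>t. poly P (cis t) * cnj (poly Q (cis t)) * complex_of_real (w t)) integrable_on {0..2 * pi}"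
  using continuous_integrand by (rule integrable_continuous_real)

lemma form_add_left: "form (P + Q) R = form P R + form Q R"
  unfolding form_def circle_inner_def
  by (subst integral_add[OF integrand_integrable integrand_integrable, symmetric])
    (simp add: algebra_simps)

lemma form_smult_left: "form (smult c P) R = c * form P R"
  unfolding form_def circle_inner_def
  by (subst integral_mult_right[symmetric]) (simp add: algebra_simps)

lemma form_cnj: "cnj (form P Q) = form Q P"
  unfolding form_def circle_inner_def
  by (subst integral_cnj) (simp add: algebra_simps)

lemma form_diff_left: "form (P - Q) R = form P R - form Q R"
  using form_add_left[of P "smult (-1) Q" R] form_smult_left[of "-1" Q R] by simp

lemma form_add_right: "form R (P + Q) = form R P + form R Q"
  by (metis form_add_left form_cnj complex_cnj_add)

lemma form_smult_right: "form R (smult c P) = cnj c * form R P"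
  by (metis form_smult_left form_cnj complex_cnj_mult)

lemma form_diff_right: "form R (P - Q) = form R P - form R Q"
  by (metis form_diff_left form_cnj complex_cnj_diff)

lemma form_sum_right: "form R (\<Sum>i\<in>A. f i) = (\<Sum>i\<in>A. form R (f i))"
proof (induction A rule: infinite_finite_induct)
  case (insert x A)
  thus ?case by (simp add: form_add_right)
qed (use form_smult_right[of R 0 0] in auto)

lemma form_cong:
  assumes "\<And>t. poly P (cis t) * cnj (poly Q (cis t)) = poly P' (cis t) * cnj (poly Q' (cis t))"
  shows "form P Q = form P' Q'"
  unfolding form_def circle_inner_def by (simp add: assms)

lemma form_shift: "form (pCons 0 P) (pCons 0 Q) = form P Q"
proof (rule form_cong)
  fix t
  have "cis t * cnj (cis t) = 1"
    by (simp add: cis_cnj cis_mult)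
  thus "poly (pCons 0 P) (cis t) * cnj (poly (pCons 0 Q) (cis t)) =
        poly P (cis t) * cnj (poly Q (cis t))"
    by (simp add: mult_ac)
qed

text \<open>A polynomial of norm zero vanishes on the whole circle, hence has infinitely many roots.\<close>

lemma form_definite:
  assumes "form P P = 0"
  shows "P = 0"
proof -
  have eq: "poly P (cis t) * cnj (poly P (cis t)) * complex_of_real (w t) =
            complex_of_real ((cmod (poly P (cis t)))\<^sup>2 * w t)" for t
    by (simp add: complex_norm_square flip: of_real_power)
  have cont: "continuous_on {0..2 * pi} (\<lambda>t. (cmod (poly P (cis t)))\<^sup>2 * w t)"
    by (intro continuous_intros continuous_weight)
  have "((\<lambda>t. complex_of_real ((cmod (poly P (cis t)))\<^sup>2 * w t)) has_integral
        complex_of_real (integral {0..2 * pi} (\<lambda>t. (cmod (poly P (cis t)))\<^sup>2 * w t))) {0..2 * pi}"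
    using integrable_integral[OF integrable_continuous_real[OF cont]] by (rule has_integral_of_real)
  hence "form P P = complex_of_real (integral {0..2 * pi} (\<lambda>t. (cmod (poly P (cis t)))\<^sup>2 * w t))"
    unfolding form_def circle_inner_def eq by (rule integral_unique)
  hence "integral {0..2 * pi} (\<lambda>t. (cmod (poly P (cis t)))\<^sup>2 * w t) = 0"
    using assms by simp
  hence "\<forall>t\<in>{0..2 * pi}. (cmod (poly P (cis t)))\<^sup>2 * w t = 0"
    by (subst (asm) integral_eq_0_iff[OF cont]) (auto simp: weight_pos less_imp_le)
  hence root: "poly P (cis t) = 0" if "t \<in> {0..2 * pi}" for t
    using weight_pos[OF that] that by fastforce
  show ?thesis
  proof (rule ccontr)
    assume "P \<noteq> 0"
    hence "finite {z. poly P z = 0}"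
      by (rule poly_roots_finite)
    hence fin: "finite (cis ` {0..pi})"
      by (rule finite_subset[rotated]) (auto intro: root)
    have "inj_on cis {0..pi}"
      by (rule inj_onI) (metis atLeastAtMost_iff arccos_cos cis.sel(1))
    hence "finite {0..pi}"
      using fin finite_image_iff by blast
    thus False
      by (simp add: infinite_Icc)
  qed
qed

text \<open>The pairing is linear in the right-hand polynomial, and among the powers up to \<open>n\<close> only
  the top one is not orthogonal to \<open>P\<close>; the choice \<open>Q = P\<close> identifies its pairing with \<open>P\<close>.\<close>

lemma form_OPUC_left:
  assumes P: "is_monic_OPUC w n P" and Q: "degree Q \<le> n"
  shows "form P Q = cnj (coeff Q n) * form P P"
proof -
  have expand: "form P R = cnj (coeff R n) * form P (monom 1 n)" if "degree R \<le> n" for R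
  proof -
    have zero: "form P (monom 1 k) = 0" if "k < n" for k
      using P that unfolding is_monic_OPUC_def form_def by (simp add: poly_monom[abs_def])
    have "form P R = form P (\<Sum>i\<le>n. smult (coeff R i) (monom 1 i))"
      using poly_as_sum_of_monoms'[OF that] by (simp add: smult_monom)
    also have "\<dots> = (\<Sum>i\<le>n. cnj (coeff R i) * form P (monom 1 i))"
      by (simp only: form_sum_right form_smult_right)
    also have "\<dots> = (\<Sum>i\<in>{n}. cnj (coeff R i) * form P (monom 1 i))"
      by (rule sum.mono_neutral_right) (auto simp: zero)
    finally show ?thesis by simp
  qed
  have "form P P = form P (monom 1 n)"
    using expand[of P] P by (auto simp: is_monic_OPUC_def)
  thus ?thesis
    using expand[OF Q] by simp
qed

text \<open>On the circle \<open>P\<^sup>* cnj Q = Q\<^sup>* cnj P\<close>, so reversal exchanges the top coefficient of \<open>Q\<close>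
  with its constant one.\<close>

lemma form_dual_left:
  assumes P: "is_monic_OPUC w n P" and Q: "degree Q \<le> n"
  shows "form (dual_poly n P) Q = cnj (coeff Q 0) * form P P"
proof -
  have "degree P \<le> n"
    using P by (simp add: is_monic_OPUC_def)
  hence "form (dual_poly n P) Q = form (dual_poly n Q) P"
    using Q by (intro form_cong) (simp add: poly_dual_poly_cis)
  also have "\<dots> = cnj (form P (dual_poly n Q))"
    by (simp add: form_cnj)
  also have "form P (dual_poly n Q) = coeff Q 0 * form P P"
    using form_OPUC_left[OF P degree_dual_poly] by (simp add: coeff_dual_poly)
  finally show ?thesis
    by (simp add: form_cnj)
qed

lemma is_monic_OPUC_unique:
  assumes P: "is_monic_OPUC w n P" and Q: "is_monic_OPUC w n Q"
  shows "P = Q"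
proof -
  have deg: "degree (P - Q) \<le> n" and lead: "coeff (P - Q) n = 0"
    using P Q by (auto simp: is_monic_OPUC_def intro!: degree_diff_le)
  have "form (P - Q) (P - Q) = 0"
    using form_OPUC_left[OF P deg] form_OPUC_left[OF Q deg] lead by (simp add: form_diff_left)
  thus ?thesis
    using form_definite by force
qed

lemma form_OPUC_self_nonzero: "is_monic_OPUC w n P \<Longrightarrow> form P P \<noteq> 0"
  using form_definite[of P] by (auto simp: is_monic_OPUC_def)

text \<open>\<open>z P\<close> is already orthogonal to \<open>z, \<dots>, z\<^sup>n\<close>, and so is the reversal of \<open>P\<close>, which is not
  orthogonal to 1; hence a multiple of the reversal corrects \<open>z P\<close>.\<close>

lemma szego_step:
  assumes P: "is_monic_OPUC w n P"
  shows "is_monic_OPUC w (Suc n)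
    (pCons 0 P - smult (form (pCons 0 P) 1 / form P P) (dual_poly n P))"
    (is "is_monic_OPUC w _ (_ - smult ?c _)")
proof -
  let ?R = "pCons 0 P - smult ?c (dual_poly n P)"
  have degP: "degree P = n" and leadP: "coeff P n = 1"
    using P by (auto simp: is_monic_OPUC_def)
  have lead: "coeff ?R (Suc n) = 1"
    using leadP by (simp add: coeff_dual_poly)
  have "degree ?R \<le> Suc n"
    using degP degree_dual_poly[of n P]
    by (intro degree_diff_le) (auto intro: degree_pCons_le[THEN order_trans]
        degree_smult_le[THEN order_trans])
  moreover have "Suc n \<le> degree ?R"
    using lead by (intro le_degree) simp
  ultimately have deg: "degree ?R = Suc n"
    by simp
  have "form ?R (monom 1 k) = 0" if "k < Suc n" for k
  proof (cases k)
    case 0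
    have "form (dual_poly n P) 1 = form P P"
      using form_dual_left[OF P, of 1] by simp
    thus ?thesis
      using 0 form_OPUC_self_nonzero[OF P]
      by (simp add: form_diff_left form_smult_left)
  next
    case (Suc j)
    have "form (pCons 0 P) (monom 1 k) = form P (monom 1 j)"
      by (simp add: Suc monom_Suc form_shift)
    also have "\<dots> = 0"
      using form_OPUC_left[OF P, of "monom 1 j"] that Suc by (simp add: degree_monom_eq)
    finally have "form (pCons 0 P) (monom 1 k) = 0" .
    moreover have "form (dual_poly n P) (monom 1 k) = 0"
      using form_dual_left[OF P, of "monom 1 k"] that Suc by (simp add: degree_monom_eq)
    ultimately show ?thesis
      by (simp add: form_diff_left form_smult_left)
  qed
  thus ?thesis
    using deg lead unfolding is_monic_OPUC_def form_def by (simp add: poly_monom[abs_def])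
qed

lemma is_monic_OPUC_exists: "\<exists>P. is_monic_OPUC w n P"
proof (induction n)
  case 0
  have "is_monic_OPUC w 0 1"
    by (simp add: is_monic_OPUC_def)
  thus ?case ..
next
  case (Suc n)
  thus ?case
    using szego_step by blast
qed

lemma monic_OPUC: "is_monic_OPUC w n (monic_OPUC w n)"
proof -
  have "\<exists>!P. is_monic_OPUC w n P"
    using is_monic_OPUC_exists is_monic_OPUC_unique by blast
  thus ?thesis
    unfolding monic_OPUC_def by (rule theI')
qed

lemma degree_monic_OPUC: "degree (monic_OPUC w n) = n"
  and coeff_monic_OPUC: "coeff (monic_OPUC w n) n = 1"
  using monic_OPUC[of n] by (auto simp: is_monic_OPUC_def)

lemma szego_recurrence:
  "monic_OPUC w (Suc n) = pCons 0 (monic_OPUC w n) +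
     smult (coeff (monic_OPUC w (Suc n)) 0) (dual_poly n (monic_OPUC w n))"
proof -
  let ?P = "monic_OPUC w n"
  define c where "c = form (pCons 0 ?P) 1 / form ?P ?P"
  have eq: "monic_OPUC w (Suc n) = pCons 0 ?P - smult c (dual_poly n ?P)"
    unfolding c_def by (rule is_monic_OPUC_unique[OF monic_OPUC szego_step[OF monic_OPUC]])
  hence "coeff (monic_OPUC w (Suc n)) 0 = - c"
    by (simp add: coeff_dual_poly coeff_monic_OPUC)
  hence c: "c = - coeff (monic_OPUC w (Suc n)) 0"
    by simp
  show ?thesis
    using eq unfolding c by simp
qed

text \<open>Pythagoras: in \<open>R = z P + a P\<^sup>*\<close> the term \<open>z P = R - a P\<^sup>*\<close> is an orthogonal
  difference, and \<open>z P\<close> and \<open>P\<^sup>*\<close> have the same norm as \<open>P\<close>.\<close>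

lemma norm_recurrence:
  fixes n defines "P \<equiv> monic_OPUC w n" and "R \<equiv> monic_OPUC w (Suc n)"
  shows "form R R = (1 - (complex_of_real (cmod (coeff R 0)))\<^sup>2) * form P P"
proof -
  let ?a = "coeff R 0" and ?D = "dual_poly n P"
  have P: "is_monic_OPUC w n P" and R: "is_monic_OPUC w (Suc n) R"
    unfolding P_def R_def by (rule monic_OPUC)+
  have "R = pCons 0 P + smult ?a ?D"
    unfolding P_def R_def by (rule szego_recurrence)
  hence zP: "pCons 0 P = R - smult ?a ?D"
    unfolding eq_diff_eq by (rule sym)
  have RD: "form R ?D = 0"
    using form_OPUC_left[OF R le_SucI[OF degree_dual_poly]] by (simp add: coeff_dual_poly)
  hence DR: "form ?D R = 0"
    by (subst form_cnj[symmetric]) simp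
  have DD: "form ?D ?D = form P P"
    using form_dual_left[OF P degree_dual_poly, of P]
    by (simp add: coeff_dual_poly P_def coeff_monic_OPUC)
  have "form P P = form (R - smult ?a ?D) (R - smult ?a ?D)"
    by (simp only: form_shift flip: zP)
  also have "\<dots> = form R R + ?a * cnj ?a * form P P"
    by (simp add: form_diff_left form_diff_right form_smult_left form_smult_right RD DR DD)
  also have "?a * cnj ?a = (complex_of_real (cmod ?a))\<^sup>2"
    using complex_norm_square[of ?a] by simp
  finally show ?thesis
    unfolding left_diff_distrib mult_1_left eq_diff_eq by (rule sym)
qed

section \<open>The difference equation\<close>

text \<open>The identity in the assumption is integration by parts for a weight whose logarithmic
  derivative is \<open>u z + cnj u / z\<close>.\<close>

lemma difference_equation:
  assumes parts: "\<And>P Q. \<i> * form (pCons 0 (pderiv P)) Q - \<i> * form P (pCons 0 (pderiv Q))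
      + u * form (pCons 0 P) Q + cnj u * form P (pCons 0 Q) = 0"
  defines "\<phi> \<equiv> \<lambda>n. coeff (monic_OPUC w n) 0"
  shows "cnj u * cnj (\<phi> (Suc (Suc n))) - u * cnj (\<phi> n) =
    \<i> * of_nat (Suc n) * cnj (\<phi> (Suc n)) / (1 - (complex_of_real (cmod (\<phi> (Suc n))))\<^sup>2)"
proof -
  define P where "P = monic_OPUC w (Suc n)"
  define P0 where "P0 = monic_OPUC w n"
  define P2 where "P2 = monic_OPUC w (Suc (Suc n))"
  define Q where "Q = dual_poly n P0"
  define h where "h = form P P"
  define h0 where "h0 = form P0 P0"
  have OP: "is_monic_OPUC w (Suc n) P" "is_monic_OPUC w n P0" "is_monic_OPUC w (Suc (Suc n)) P2"
    unfolding P_def P0_def P2_def by (rule monic_OPUC)+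
  have lead: "coeff P (Suc n) = 1" "coeff P0 n = 1"
    unfolding P_def P0_def by (rule coeff_monic_OPUC)+
  have degP: "degree P = Suc n"
    unfolding P_def by (rule degree_monic_OPUC)
  have degQ: "degree Q \<le> n"
    unfolding Q_def by (rule degree_dual_poly)
  have coeffQ: "coeff Q 0 = 1" "coeff Q n = cnj (\<phi> n)" "coeff Q (Suc n) = 0"
    using lead by (simp_all add: Q_def coeff_dual_poly P0_def \<phi>_def)

  \<comment> \<open>The leading terms of \<open>z P'\<close> and \<open>(n + 1) P\<close> agree, so their difference has degree at most
    \<open>n\<close>, as \<open>form_dual_left\<close> requires.\<close>
  define D where "D = pCons 0 (pderiv P) - smult (of_nat (Suc n)) P"
  have "degree D \<le> n"
  proof (rule degree_le, intro allI impI)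
    fix i assume i: "n < i"
    show "coeff D i = 0"
    proof (cases "i = Suc n")
      case True
      thus ?thesis
        using lead by (simp add: D_def coeff_pderiv)
    next
      case False
      then obtain j where "i = Suc j" "j > n"
        using i by (cases i) auto
      thus ?thesis
        using degP by (simp add: D_def coeff_pderiv coeff_eq_0)
    qed
  qed
  hence "form Q D = cnj (coeff D 0) * h0"
    unfolding Q_def h0_def by (rule form_dual_left[OF OP(2)])
  moreover have "coeff D 0 = - of_nat (Suc n) * \<phi> (Suc n)"
    by (simp add: D_def \<phi>_def P_def algebra_simps)
  ultimately have "form D Q = - of_nat (Suc n) * \<phi> (Suc n) * h0"
    by (subst form_cnj[symmetric]) (simp add: h0_def form_cnj)
  moreover have PQ: "form P Q = 0"
    using form_OPUC_left[OF OP(1), of Q] degQ coeffQ by simp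
  ultimately have t1: "form (pCons 0 (pderiv P)) Q = - of_nat (Suc n) * \<phi> (Suc n) * h0"
    by (simp add: D_def form_diff_left form_smult_left)

  have deg_zQ': "degree (pCons 0 (pderiv Q)) \<le> Suc n"
    using degQ by (intro order_trans[OF degree_pCons_le]) (simp add: degree_pderiv)
  have t2: "form P (pCons 0 (pderiv Q)) = 0"
    using form_OPUC_left[OF OP(1) deg_zQ'] coeffQ by (simp add: coeff_pderiv)

  have "P2 = pCons 0 P + smult (\<phi> (Suc (Suc n))) (dual_poly (Suc n) P)"
    unfolding P_def P2_def \<phi>_def by (rule szego_recurrence)
  hence "pCons 0 P = P2 - smult (\<phi> (Suc (Suc n))) (dual_poly (Suc n) P)"
    by simp
  moreover have "form P2 Q = 0"
    using form_OPUC_left[OF OP(3), of Q] degQ by (simp add: coeff_eq_0)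
  moreover have "form (dual_poly (Suc n) P) Q = h"
    using form_dual_left[OF OP(1), of Q] degQ coeffQ by (simp add: h_def)
  ultimately have t3: "form (pCons 0 P) Q = - \<phi> (Suc (Suc n)) * h"
    by (simp only: form_diff_left form_smult_left) simp

  have "degree (pCons 0 Q) \<le> Suc n"
    using degQ by (intro order_trans[OF degree_pCons_le]) simp
  hence t4: "form P (pCons 0 Q) = \<phi> n * h"
    using form_OPUC_left[OF OP(1), of "pCons 0 Q"] coeffQ by (simp add: h_def)

  have hrec: "h = (1 - (complex_of_real (cmod (\<phi> (Suc n))))\<^sup>2) * h0"
    unfolding h_def h0_def P_def P0_def \<phi>_def by (rule norm_recurrence)
  have nz: "h \<noteq> 0" "cnj h0 = h0"
    unfolding h_def h0_def using form_OPUC_self_nonzero[OF OP(1)] by (simp_all add: form_cnj)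
  define r where "r = 1 - (complex_of_real (cmod (\<phi> (Suc n))))\<^sup>2"
  have r: "h = r * h0" "r \<noteq> 0" "h0 \<noteq> 0" "cnj r = r"
    using hrec nz by (auto simp: r_def)
  have "- \<i> * of_nat (Suc n) * \<phi> (Suc n) * h0 - u * \<phi> (Suc (Suc n)) * (r * h0)
      + cnj u * \<phi> n * (r * h0) = 0"
    using parts[of P Q] unfolding t1 t2 t3 t4 by (simp add: r(1) algebra_simps)
  hence "h0 * (- \<i> * of_nat (Suc n) * \<phi> (Suc n) - (u * \<phi> (Suc (Suc n)) - cnj u * \<phi> n) * r) = 0"
    by (simp add: algebra_simps)
  hence "- \<i> * of_nat (Suc n) * \<phi> (Suc n) = (u * \<phi> (Suc (Suc n)) - cnj u * \<phi> n) * r"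
    using r(3) by simp
  hence "cnj (- \<i> * of_nat (Suc n) * \<phi> (Suc n)) = cnj ((u * \<phi> (Suc (Suc n)) - cnj u * \<phi> n) * r)"
    by simp
  hence "\<i> * of_nat (Suc n) * cnj (\<phi> (Suc n)) =
      (cnj u * cnj (\<phi> (Suc (Suc n))) - u * cnj (\<phi> n)) * r"
    by (simp add: r(4))
  thus ?thesis
    using r(2) unfolding r_def[symmetric] by (simp add: field_simps)
qed

end

section \<open>The exponential weight\<close>

lemma integration_by_parts:
  fixes u :: complex and \<tau> :: real and w :: "real \<Rightarrow> real"
  assumes w: "\<And>t. t \<in> {0..2 * pi} \<Longrightarrow> w t = \<tau> * exp (2 * cmod u * sin (t + Arg u))"
    and "circle_weight w"
  shows "\<i> * circle_weight.form w (pCons 0 (pderiv P)) Q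
      - \<i> * circle_weight.form w P (pCons 0 (pderiv Q))
      + u * circle_weight.form w (pCons 0 P) Q + cnj u * circle_weight.form w P (pCons 0 Q) = 0"
proof -
  interpret circle_weight w by fact
  define v where "v t = \<tau> * exp (2 * cmod u * sin (t + Arg u))" for t
  define F where "F t = poly P (cis t) * cnj (poly Q (cis t)) * complex_of_real (v t)" for t
  define F' where "F' t = (\<i> * poly (pCons 0 (pderiv P)) (cis t) * cnj (poly Q (cis t))
      - \<i> * poly P (cis t) * cnj (poly (pCons 0 (pderiv Q)) (cis t))
      + u * poly (pCons 0 P) (cis t) * cnj (poly Q (cis t))
      + cnj u * poly P (cis t) * cnj (poly (pCons 0 Q) (cis t))) * complex_of_real (v t)" for t
  have dcis: "(cis has_vector_derivative \<i> * cis t) (at t within S)" for t S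
    unfolding has_vector_derivative_def using has_derivative_cis[OF has_derivative_ident] .
  have dpoly: "((\<lambda>t. poly R (cis t)) has_vector_derivative \<i> * cis t * poly (pderiv R) (cis t))
      (at t within S)" for R t S
    using field_vector_diff_chain_within[OF dcis
        has_field_derivative_at_within[OF poly_DERIV[of R "cis t"]]]
    by (simp add: o_def)
  have log_deriv: "complex_of_real (2 * cmod u * cos (t + Arg u)) = u * cis t + cnj (u * cis t)" for t
  proof -
    have "u * cis t = rcis (cmod u) (t + Arg u)"
      using rcis_mult[of "cmod u" "Arg u" 1 t] by (simp add: rcis_cmod_Arg cis_rcis_eq add.commute)
    hence "Re (u * cis t) = cmod u * cos (t + Arg u)"
      by simp
    thus ?thesis
      by (metis complex_add_cnj mult.assoc)
  qed
  have dv: "((\<lambda>t. complex_of_real (v t)) has_vector_derivative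
      (u * cis t + cnj (u * cis t)) * complex_of_real (v t)) (at t within S)" for t S
  proof -
    have "(v has_real_derivative 2 * cmod u * cos (t + Arg u) * v t) (at t within S)"
      unfolding v_def by (auto intro!: derivative_eq_intros)
    hence "((\<lambda>t. complex_of_real (v t)) has_vector_derivative
        complex_of_real (2 * cmod u * cos (t + Arg u) * v t)) (at t within S)"
      by (rule has_vector_derivative_of_real)
    thus ?thesis
      by (simp only: of_real_mult[of _ "v t"] log_deriv)
  qed
  have "(F has_vector_derivative F' t) (at t within S)" for t S
    unfolding F_def F'_def
    by (rule has_vector_derivative_eq_rhs,
        rule has_vector_derivative_mult[OF has_vector_derivative_mult[OF dpoly
          has_vector_derivative_cnj[OF dpoly]] dv])
       (simp add: algebra_simps)
  hence "(F' has_integral (F (2 * pi) - F 0)) {0..2 * pi}"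
    by (intro fundamental_theorem_of_calculus) auto
  moreover have "F (2 * pi) = F 0"
    by (simp add: F_def v_def sin_add)
  ultimately have zero: "integral {0..2 * pi} F' = 0"
    by (simp add: integral_unique)
  have form: "form R S =
      integral {0..2 * pi} (\<lambda>t. poly R (cis t) * cnj (poly S (cis t)) * complex_of_real (v t))"
    for R S
    unfolding form_def circle_inner_def
    by (rule integral_cong) (simp add: w v_def)
  have int: "((\<lambda>t. poly R (cis t) * cnj (poly S (cis t)) * complex_of_real (v t)) has_integral
      form R S) {0..2 * pi}" for R S
    unfolding form
    by (rule integrable_integral, rule integrable_eq[OF integrand_integrable[of R S]])
       (simp add: w v_def)
  have "(F' has_integral (\<i> * form (pCons 0 (pderiv P)) Q - \<i> * form P (pCons 0 (pderiv Q))
      + u * form (pCons 0 P) Q + cnj u * form P (pCons 0 Q))) {0..2 * pi}"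
    by (rule has_integral_eq[rotated],
        rule has_integral_add[OF has_integral_add[OF has_integral_diff[
          OF has_integral_mult_right[OF int] has_integral_mult_right[OF int]]
          has_integral_mult_right[OF int]] has_integral_mult_right[OF int]])
       (simp add: F'_def algebra_simps)
  thus ?thesis
    using zero by (simp add: integral_unique)
qed

theorem mainTheorem7:
  fixes u :: complex and \<tau> :: real and w :: "real \<Rightarrow> real" and \<alpha> :: "int \<Rightarrow> complex"
  assumes "u \<noteq> 0"
    and "\<tau> > 0"
    and "\<And>\<theta>. \<theta> \<in> {0..2 * pi} \<Longrightarrow> w \<theta> = \<tau> * exp (2 * cmod u * sin (\<theta> + Arg u))"
    and "(w has_integral 1) {0..2 * pi}"
    and "\<And>k. \<alpha> k = verblunsky w k"
  shows "\<forall>n::int. n \<ge> 2 \<longrightarrow>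
    cnj (\<i> * u) * \<alpha> n + \<i> * u * \<alpha> (n - 2) =
      of_int n * \<alpha> (n - 1) / (1 - (complex_of_real (cmod (\<alpha> (n - 1))))\<^sup>2)"
proof (intro allI impI)
  fix n :: int assume "n \<ge> 2"
  then obtain m where n: "n = int (Suc m)"
    by (metis nonneg_int_cases not0_implies_Suc of_nat_0 not_numeral_le_zero order_trans
        zero_le_numeral)
  have "continuous_on {0..2 * pi} (\<lambda>\<theta>. \<tau> * exp (2 * cmod u * sin (\<theta> + Arg u)))"
    by (intro continuous_intros)
  hence "circle_weight w"
    using assms(2,3) by unfold_locales (auto cong: continuous_on_cong_simp)
  then interpret circle_weight w .
  define \<phi> where "\<phi> k = coeff (monic_OPUC w k) 0" for k
  have \<alpha>: "\<alpha> n = - cnj (\<phi> (Suc (Suc m)))" "\<alpha> (n - 1) = - cnj (\<phi> (Suc m))"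
      "\<alpha> (n - 2) = - cnj (\<phi> m)"
    by (simp_all add: assms(5) verblunsky_def \<phi>_def poly_0_coeff_0 n nat_add_distrib)
  have "cnj u * cnj (\<phi> (Suc (Suc m))) - u * cnj (\<phi> m) =
      \<i> * of_nat (Suc m) * cnj (\<phi> (Suc m)) / (1 - (complex_of_real (cmod (\<phi> (Suc m))))\<^sup>2)"
    unfolding \<phi>_def
    by (rule difference_equation[OF integration_by_parts[OF assms(3) \<open>circle_weight w\<close>]])
  hence "\<i> * (cnj u * cnj (\<phi> (Suc (Suc m))) - u * cnj (\<phi> m)) =
      \<i> * (\<i> * of_nat (Suc m) * cnj (\<phi> (Suc m)) /
        (1 - (complex_of_real (cmod (\<phi> (Suc m))))\<^sup>2))"
    by (rule arg_cong)
  thus "cnj (\<i> * u) * \<alpha> n + \<i> * u * \<alpha> (n - 2) =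
      of_int n * \<alpha> (n - 1) / (1 - (complex_of_real (cmod (\<alpha> (n - 1))))\<^sup>2)"
    unfolding \<alpha> unfolding n by (simp add: algebra_simps)
qed

end
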